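(* Let $n=2^r$ with $r\ge 3$, and let $A$ be the $n\times n$ square constructed by the procedure (the twelve Up/Down operations performed for each $j=0,1,\dots,n/8-1$) described in the context. Then $A$ is a Franklin square (in the sense defined in the context).
   Context: Throughout, $n=2^r$ with $r\ge 3$, $N=n^2+1$ and $M=\frac n2 N$ (the magic sum). $A_{i,j}$ denotes the entry of $A$ in row $i$ and column $j$, $1\le i,j\le n$ (rows numbered from top to bottom, columns from left to right). **Franklin square.** An $n\times n$ Franklin square is an $n\times n$ matrix $A$ with the following properties. 1. Every integer from $\{1,2,\dots,n^2\}$ occurs exactly once as an entry of $A$. 2. Every half row and every half column adds to $M/2$: for every row $i$, $\sum_{j=1}^{n/2}A_{i,j}=\sum_{j=n/2+1}^{n}A_{i,j}=M/2$, and for every column $j$, $\sum_{i=1}^{n/2}A_{i,j}=\sum_{i=n/2+1}^{n}A_{i,j}=M/2$. (Consequently all rows and columns add to $M$.) 3. All bend diagonals add to $M$, continuously (i.e. with opposite sides of the square glued as on a torus). Explicitly, with row and column indices read modulo $n$ in $\{1,\dots,n\}$: for every $k\in\{1,\dots,n\}$ each of the four sums $$\sum_{i=0}^{n/2-1}\bigl(A_{k+i,\,1+i}+A_{k+i,\,n-i}\bigr),\qquad \sum_{i=0}^{n/2-1}\bigl(A_{k-i,\,1+i}+A_{k-i,\,n-i}\bigr),$$ $$\sum_{i=0}^{n/2-1}\bigl(A_{1+i,\,k+i}+A_{n-i,\,k+i}\bigr),\qquad \sum_{i=0}^{n/2-1}\bigl(A_{1+i,\,k-i}+A_{n-i,\,k-i}\bigr)$$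 equals $M$. 4. All $2\times 2$ sub-squares add to $4M/n=2N$, continuously: for all $i,j\in\{1,\dots,n\}$, with indices read modulo $n$, $A_{i,j}+A_{i,j+1}+A_{i+1,j}+A_{i+1,j+1}=2N$. (Consequently all $4\times 4$ sub-squares add to $8N$, and the four corner entries together with the four middle entries add to $4N$.) **Parts.** The top part consists of rows $1,\dots,n/4$; the middle part of rows $n/4+1,\dots,3n/4$; the bottom part of rows $3n/4+1,\dots,n$. For a part $p$, let $rf$ and $rl$ be its first and last row. **Operations.** Each operation takes a part $p$, two columns $cs$ and $ca$, a starting number $s$, and a number $e$, where $e=n/8$ for the top and bottom parts and $e=n/4$ for the middle part (half the number of rows of $p$). Up$(p,cs,ca,s)$: for $i=0,\dots,e-1$, put $t=s+2i$ and assign $$A_{rl-2i,\,cs}=t,\quad A_{rl-2i,\,ca}=N-t,\quad A_{rl-1-2i,\,cs}=N-(t+1),\quad A_{rl-1-2i,\,ca}=t+1.$$ Down$(p,cs,ca,s)$: for $i=0,\dots,e-1$, put $t=s+2i$ and assign $$A_{rf+2i,\,cs}=N-t,\quad A_{rf+2i,\,ca}=t,\quad A_{rf+1+2i,\,cs}=t+1,\quad A_{rf+1+2i,\,ca}=N-(t+1).$$ **Procedure.** For each $j=0,1,\dots,n/8-1$ perform the following operations. Left side (columns $1,\dots,n/2$): - Up(bottom, $cs=\frac n4-2j$, $ca=\frac n4+1+2j$, $s=1+2jn$); - Up(top, $cs=\frac n4-2j$, $ca=\frac n4+1+2j$, $s=\frac n4+1+2jn$); - Down(middle, $cs=\frac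 n4-2j$, $ca=\frac n4+1+2j$, $s=\frac n2+1+2jn$); - Up(middle, $cs=\frac n4-1-2j$, $ca=\frac n4+2+2j$, $s=n+1+2jn$); - Down(top, $cs=\frac n4-1-2j$, $ca=\frac n4+2+2j$, $s=\frac{3n}2+1+2jn$); - Down(bottom, $cs=\frac n4-1-2j$, $ca=\frac n4+2+2j$, $s=\frac{7n}4+1+2jn$). Right side (columns $n/2+1,\dots,n$): - Up(bottom, $cs=n-2j$, $ca=\frac n2+1+2j$, $s=\frac{n^2}4+1+2jn$); - Up(top, $cs=n-2j$, $ca=\frac n2+1+2j$, $s=\frac{n^2}4+\frac n4+1+2jn$); - Down(middle, $cs=n-2j$, $ca=\frac n2+1+2j$, $s=\frac{n^2}4+\frac n2+1+2jn$); - Up(middle, $cs=n-1-2j$, $ca=\frac n2+2+2j$, $s=\frac{n^2}4+n+1+2jn$); - Down(top, $cs=n-1-2j$, $ca=\frac n2+2+2j$, $s=\frac{n^2}4+\frac{3n}2+1+2jn$); - Down(bottom, $cs=n-1-2j$, $ca=\frac n2+2+2j$, $s=\frac{n^2}4+\frac{7n}4+1+2jn$). These operations assign each entry of $A$ exactly once. *)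

theory Defs
  imports Main
begin

text \<open>
  A square is a function from row and column to entry; only indices in \<open>{1..n}\<close> are meaningful,
  rows being numbered from top to bottom and columns from left to right. Everything here is used
  for \<open>n = 2 ^ r\<close> with \<open>r \<ge> 3\<close>, so all divisions by 2, 4 and 8 below are exact.
\<close>

type_synonym square = "int \<Rightarrow> int \<Rightarrow> int"

definition NN :: "int \<Rightarrow> int" where
  "NN n = n\<^sup>2 + 1"

definition magic_sum :: "int \<Rightarrow> int" where
  "magic_sum n = (n div 2) * NN n"

text \<open>The representative of \<open>x\<close> modulo \<open>n\<close> in \<open>{1..n}\<close>.\<close>

definition wrap :: "int \<Rightarrow> int \<Rightarrow> int" where
  "wrap n x = (x - 1) mod n + 1"

definition entries_once :: "int \<Rightarrow> square \<Rightarrow> bool" where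
  "entries_once n A \<longleftrightarrow>
     (\<forall>m\<in>{1..n\<^sup>2}. \<exists>!p. p \<in> {1..n} \<times> {1..n} \<and> A (fst p) (snd p) = m)"

definition half_sums :: "int \<Rightarrow> square \<Rightarrow> bool" where
  "half_sums n A \<longleftrightarrow>
     (\<forall>i\<in>{1..n}. (\<Sum>j=1..n div 2. A i j) = magic_sum n div 2 \<and>
                 (\<Sum>j=n div 2 + 1..n. A i j) = magic_sum n div 2) \<and>
     (\<forall>j\<in>{1..n}. (\<Sum>i=1..n div 2. A i j) = magic_sum n div 2 \<and>
                 (\<Sum>i=n div 2 + 1..n. A i j) = magic_sum n div 2)"

definition bend_diagonals :: "int \<Rightarrow> square \<Rightarrow> bool" where
  "bend_diagonals n A \<longleftrightarrow>
     (\<forall>k\<in>{1..n}.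
        (\<Sum>i=0..n div 2 - 1. A (wrap n (k + i)) (1 + i) + A (wrap n (k + i)) (n - i)) = magic_sum n \<and>
        (\<Sum>i=0..n div 2 - 1. A (wrap n (k - i)) (1 + i) + A (wrap n (k - i)) (n - i)) = magic_sum n \<and>
        (\<Sum>i=0..n div 2 - 1. A (1 + i) (wrap n (k + i)) + A (n - i) (wrap n (k + i))) = magic_sum n \<and>
        (\<Sum>i=0..n div 2 - 1. A (1 + i) (wrap n (k - i)) + A (n - i) (wrap n (k - i))) = magic_sum n)"

definition two_by_two_sums :: "int \<Rightarrow> square \<Rightarrow> bool" where
  "two_by_two_sums n A \<longleftrightarrow>
     (\<forall>i\<in>{1..n}. \<forall>j\<in>{1..n}.
        A i j + A i (wrap n (j + 1)) + A (wrap n (i + 1)) j + A (wrap n (i + 1)) (wrap n (j + 1))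
          = 2 * NN n)"

definition franklin_square :: "int \<Rightarrow> square \<Rightarrow> bool" where
  "franklin_square n A \<longleftrightarrow>
     entries_once n A \<and> half_sums n A \<and> bend_diagonals n A \<and> two_by_two_sums n A"

datatype part = Top | Middle | Bottom

fun first_row :: "int \<Rightarrow> part \<Rightarrow> int" where
  "first_row n Top = 1"
| "first_row n Middle = n div 4 + 1"
| "first_row n Bottom = 3 * n div 4 + 1"

fun last_row :: "int \<Rightarrow> part \<Rightarrow> int" where
  "last_row n Top = n div 4"
| "last_row n Middle = 3 * n div 4"
| "last_row n Bottom = n"

fun half_height :: "int \<Rightarrow> part \<Rightarrow> int" where
  "half_height n Top = n div 8"
| "half_height n Middle = n div 4"
| "half_height n Bottom = n div 8"

definition assign :: "int \<Rightarrow> int \<Rightarrow> int \<Rightarrow> square \<Rightarrow> square" where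
  "assign i j v A = A(i := (A i)(j := v))"

definition up :: "int \<Rightarrow> part \<Rightarrow> int \<Rightarrow> int \<Rightarrow> int \<Rightarrow> square \<Rightarrow> square" where
  "up n p cs ca s =
     fold (\<lambda>i A. let t = s + 2 * i; rl = last_row n p in
             assign (rl - 1 - 2 * i) ca (t + 1)
            (assign (rl - 1 - 2 * i) cs (NN n - (t + 1))
            (assign (rl - 2 * i) ca (NN n - t)
            (assign (rl - 2 * i) cs t A))))
       [0..half_height n p - 1]"

definition down :: "int \<Rightarrow> part \<Rightarrow> int \<Rightarrow> int \<Rightarrow> int \<Rightarrow> square \<Rightarrow> square" where
  "down n p cs ca s =
     fold (\<lambda>i A. let t = s + 2 * i; rf = first_row n p in
             assign (rf + 1 + 2 * i) ca (NN n - (t + 1))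
            (assign (rf + 1 + 2 * i) cs (t + 1)
            (assign (rf + 2 * i) ca t
            (assign (rf + 2 * i) cs (NN n - t) A))))
       [0..half_height n p - 1]"

definition left_ops :: "int \<Rightarrow> int \<Rightarrow> (square \<Rightarrow> square) list" where
  "left_ops n j =
    [up   n Bottom (n div 4 - 2*j)     (n div 4 + 1 + 2*j) (1 + 2*j*n),
     up   n Top    (n div 4 - 2*j)     (n div 4 + 1 + 2*j) (n div 4 + 1 + 2*j*n),
     down n Middle (n div 4 - 2*j)     (n div 4 + 1 + 2*j) (n div 2 + 1 + 2*j*n),
     up   n Middle (n div 4 - 1 - 2*j) (n div 4 + 2 + 2*j) (n + 1 + 2*j*n),
     down n Top    (n div 4 - 1 - 2*j) (n div 4 + 2 + 2*j) (3 * n div 2 + 1 + 2*j*n),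
     down n Bottom (n div 4 - 1 - 2*j) (n div 4 + 2 + 2*j) (7 * n div 4 + 1 + 2*j*n)]"

definition right_ops :: "int \<Rightarrow> int \<Rightarrow> (square \<Rightarrow> square) list" where
  "right_ops n j =
    [up   n Bottom (n - 2*j)     (n div 2 + 1 + 2*j) (n\<^sup>2 div 4 + 1 + 2*j*n),
     up   n Top    (n - 2*j)     (n div 2 + 1 + 2*j) (n\<^sup>2 div 4 + n div 4 + 1 + 2*j*n),
     down n Middle (n - 2*j)     (n div 2 + 1 + 2*j) (n\<^sup>2 div 4 + n div 2 + 1 + 2*j*n),
     up   n Middle (n - 1 - 2*j) (n div 2 + 2 + 2*j) (n\<^sup>2 div 4 + n + 1 + 2*j*n),
     down n Top    (n - 1 - 2*j) (n div 2 + 2 + 2*j) (n\<^sup>2 div 4 + 3 * n div 2 + 1 + 2*j*n),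
     down n Bottom (n - 1 - 2*j) (n div 2 + 2 + 2*j) (n\<^sup>2 div 4 + 7 * n div 4 + 1 + 2*j*n)]"

text \<open>
  The procedure as a transformation of an initial square. Operations are performed in list order;
  the initial contents play the role of the yet unassigned entries.
\<close>

definition procedure :: "int \<Rightarrow> square \<Rightarrow> square" where
  "procedure n =
     fold (\<lambda>j A. fold (\<lambda>f B. f B) (left_ops n j @ right_ops n j) A) [0..n div 8 - 1]"

end

theory Submission
  imports Defs
begin

text \<open>
  With \<open>n = 8 q\<close>, the procedure writes the numbers \<open>1, \<dots>, n\<^sup>2 div 2\<close> into pairs of columns, running
  boustrophedon through the rows in the fixed order given by \<open>row_rank\<close>, and puts the complements
  to \<open>N\<close> next to them. Writing \<open>s x = (- 1) ^ x\<close>, this amounts to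
  \<open>2 A\<^sub>R\<^sub>c = N + s R * b c + s c * a R\<close>
  for functions \<open>a\<close> of the row and \<open>b\<close> of the column alone. In each of the required sums the
  alternating signs, together with the symmetries of \<open>a\<close> and \<open>b\<close> under reflections and under the
  shift by \<open>n div 4\<close>, make everything but \<open>N\<close> cancel.
\<close>

section \<open>A closed form for the square\<close>

text \<open>Rank in the order bottom part upwards, top part upwards, middle part downwards, in which
  the first three operations on either side visit the rows.\<close>

definition row_rank :: "int \<Rightarrow> int \<Rightarrow> int" where
  "row_rank q R = (if R \<le> 2*q then 4*q - R else if R \<le> 6*q then 2*q + R - 1 else 8*q - R)"

text \<open>Each rank from \<open>0\<close> to \<open>4*q - 1\<close> belongs to one outer and one
  inner column of the square: the \<open>cs\<close> and \<open>ca\<close> shared by three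
  operations.\<close>

definition col_rank :: "int \<Rightarrow> int \<Rightarrow> int" where
  "col_rank q c = (if c \<le> 2*q then 2*q - c else if c \<le> 6*q then c - 2*q - 1 else 10*q - c)"

definition outer_col :: "int \<Rightarrow> int \<Rightarrow> bool" where
  "outer_col q c \<longleftrightarrow> c \<le> 2*q \<or> 6*q < c"

text \<open>Odd \<open>d\<close> belongs to the last three operations of a side, which visit the
  rows in reverse order; hence \<open>8*q - u\<close>.\<close>

definition small_value :: "int \<Rightarrow> int \<Rightarrow> int \<Rightarrow> int" where
  "small_value q d u = 8*q*d + (if even d then u + 1 else 8*q - u)"

text \<open>Last rows of parts are even and first rows odd, so both \<open>up\<close> and
  \<open>down\<close> put the small number into \<open>cs\<close> on even rows and into
  \<open>ca\<close> on odd rows.\<close>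

definition entry :: "int \<Rightarrow> square" where
  "entry q R c =
     (if even R \<longleftrightarrow> outer_col q c then small_value q (col_rank q c) (row_rank q R)
      else NN (8*q) - small_value q (col_rank q c) (row_rank q R))"

text \<open>
  A step that fills \<open>C\<close> also preserves the entries that already agree with the target \<open>T\<close>, so the
  order of the operations is irrelevant.
\<close>

definition fills :: "square \<Rightarrow> (int \<times> int) set \<Rightarrow> (square \<Rightarrow> square) \<Rightarrow> bool" where
  "fills T C f \<longleftrightarrow> (\<forall>A i j. (i, j) \<in> C \<or> A i j = T i j \<longrightarrow> f A i j = T i j)"

lemma fills_mono: "fills T C f \<Longrightarrow> D \<subseteq> C \<Longrightarrow> fills T D f"
  by (auto simp: fills_def)

lemma fills_fold:
  assumes "\<And>x. x \<in> set xs \<Longrightarrow> fills T (C x) (f x)"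
  shows "fills T (\<Union>x\<in>set xs. C x) (fold f xs)"
  using assms
proof (induction xs)
  case (Cons x xs)
  then have "fills T (C x) (f x)" "fills T (\<Union>x\<in>set xs. C x) (fold f xs)"
    by simp_all
  then show ?case
    unfolding fills_def by simp
qed (simp add: fills_def)

lemma fills_fold_ops:
  assumes "list_all2 (fills T) Cs fs"
  shows "fills T (\<Union>(set Cs)) (fold (\<lambda>f B. f B) fs)"
  using assms
proof (induction rule: list_all2_induct)
  case (Cons C Cs f fs)
  then show ?case
    unfolding fills_def by simp
qed (simp add: fills_def)

text \<open>The hypothesis runs over single rows at distance \<open>x\<close> above the last row;
  iteration \<open>i\<close> covers \<open>x = 2*i\<close> and \<open>x = 2*i + 1\<close>.\<close>

lemma fills_up:
  fixes n rl :: int and p :: part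
  defines "rl \<equiv> last_row n p"
  assumes "\<And>x. 0 \<le> x \<Longrightarrow> x < 2 * half_height n p \<Longrightarrow>
      T (rl - x) cs = (if even x then s + x else NN n - (s + x)) \<and>
      T (rl - x) ca = (if even x then NN n - (s + x) else s + x)"
  shows "fills T ({rl - 2 * half_height n p<..rl} \<times> {cs, ca}) (up n p cs ca s)"
proof -
  let ?h = "half_height n p"
  let ?C = "\<lambda>i. {rl - 2*i, rl - 1 - 2*i} \<times> {cs, ca}"
  have "fills T (\<Union>i\<in>set [0..?h - 1]. ?C i) (up n p cs ca s)"
    unfolding up_def
  proof (rule fills_fold)
    fix i assume "i \<in> set [0..?h - 1]"
    then have "0 \<le> i" "i < ?h" by auto
    then have "T (rl - 2*i) cs = s + 2*i" "T (rl - 2*i) ca = NN n - (s + 2*i)"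
      "T (rl - 1 - 2*i) cs = NN n - (s + 2*i + 1)" "T (rl - 1 - 2*i) ca = s + 2*i + 1"
      using assms(2)[of "2*i"] assms(2)[of "2*i + 1"] by (simp_all add: algebra_simps)
    then show "fills T (?C i) (\<lambda>A. let t = s + 2 * i; rl = last_row n p in
             assign (rl - 1 - 2 * i) ca (t + 1)
            (assign (rl - 1 - 2 * i) cs (NN n - (t + 1))
            (assign (rl - 2 * i) ca (NN n - t)
            (assign (rl - 2 * i) cs t A))))"
      by (auto simp: fills_def assign_def Let_def rl_def)
  qed
  moreover have "{rl - 2 * ?h<..rl} \<times> {cs, ca} \<subseteq> (\<Union>i\<in>set [0..?h - 1]. ?C i)"
  proof clarify
    fix R c assume R: "R \<in> {rl - 2 * ?h<..rl}" and "c \<in> {cs, ca}"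
    moreover from R have "(rl - R) div 2 \<in> set [0..?h - 1]" by auto
    moreover have "R \<in> {rl - 2*((rl - R) div 2), rl - 1 - 2*((rl - R) div 2)}"
      by simp presburger
    ultimately show "(R, c) \<in> (\<Union>i\<in>set [0..?h - 1]. ?C i)" by blast
  qed
  ultimately show ?thesis by (rule fills_mono)
qed

lemma fills_down:
  fixes n rf :: int and p :: part
  defines "rf \<equiv> first_row n p"
  assumes "\<And>x. 0 \<le> x \<Longrightarrow> x < 2 * half_height n p \<Longrightarrow>
      T (rf + x) cs = (if even x then NN n - (s + x) else s + x) \<and>
      T (rf + x) ca = (if even x then s + x else NN n - (s + x))"
  shows "fills T ({rf..<rf + 2 * half_height n p} \<times> {cs, ca}) (down n p cs ca s)"
proof -
  let ?h = "half_height n p"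
  let ?C = "\<lambda>i. {rf + 2*i, rf + 1 + 2*i} \<times> {cs, ca}"
  have "fills T (\<Union>i\<in>set [0..?h - 1]. ?C i) (down n p cs ca s)"
    unfolding down_def
  proof (rule fills_fold)
    fix i assume "i \<in> set [0..?h - 1]"
    then have "0 \<le> i" "i < ?h" by auto
    then show "fills T (?C i) (\<lambda>A. let t = s + 2 * i; rf = first_row n p in
             assign (rf + 1 + 2 * i) ca (NN n - (t + 1))
            (assign (rf + 1 + 2 * i) cs (t + 1)
            (assign (rf + 2 * i) ca t
            (assign (rf + 2 * i) cs (NN n - t) A))))"
      using assms(2)[of "2*i"] assms(2)[of "2*i + 1"]
      by (auto simp: fills_def assign_def Let_def rf_def algebra_simps)
  qed
  moreover have "{rf..<rf + 2 * ?h} \<times> {cs, ca} \<subseteq> (\<Union>i\<in>set [0..?h - 1]. ?C i)"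
  proof clarify
    fix R c assume R: "R \<in> {rf..<rf + 2 * ?h}" and "c \<in> {cs, ca}"
    moreover from R have "(R - rf) div 2 \<in> set [0..?h - 1]" by auto
    moreover have "R \<in> {rf + 2*((R - rf) div 2), rf + 1 + 2*((R - rf) div 2)}"
      by simp presburger
    ultimately show "(R, c) \<in> (\<Union>i\<in>set [0..?h - 1]. ?C i)" by blast
  qed
  ultimately show ?thesis by (rule fills_mono)
qed

section \<open>From single operations to the whole procedure\<close>

definition part_rows :: "int \<Rightarrow> part \<Rightarrow> int set" where
  "part_rows q p = (case p of Top \<Rightarrow> {1..2*q} | Middle \<Rightarrow> {2*q + 1..6*q} | Bottom \<Rightarrow> {6*q + 1..8*q})"

lemma fills_entry_up:
  assumes n: "n = 8*q"
    and cols: "outer_col q cs" "\<not> outer_col q ca" "col_rank q ca = col_rank q cs"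
    and start: "\<And>R. R \<in> part_rows q p \<Longrightarrow>
      small_value q (col_rank q cs) (row_rank q R) = s + (last_row n p - R)"
  shows "fills (entry q) (part_rows q p \<times> {cs, ca}) (up n p cs ca s)"
proof -
  \<comment> \<open>This turns the parity of the offset in \<open>fills_up\<close> into the parity
    of the row in \<open>entry\<close>.\<close>
  have "even (last_row n p)"
    using n by (cases p) auto
  moreover have "last_row n p - x \<in> part_rows q p" if "0 \<le> x" "x < 2 * half_height n p" for x
    using that n by (cases p) (auto simp: part_rows_def)
  ultimately have "fills (entry q) ({last_row n p - 2 * half_height n p<..last_row n p} \<times> {cs, ca})
      (up n p cs ca s)"
    using cols start n by (intro fills_up) (auto simp: entry_def)
  then show ?thesis
    by (rule fills_mono) (use n in \<open>cases p; auto simp: part_rows_def\<close>)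
qed

lemma fills_entry_down:
  assumes n: "n = 8*q"
    and cols: "outer_col q cs" "\<not> outer_col q ca" "col_rank q ca = col_rank q cs"
    and start: "\<And>R. R \<in> part_rows q p \<Longrightarrow>
      small_value q (col_rank q cs) (row_rank q R) = s + (R - first_row n p)"
  shows "fills (entry q) (part_rows q p \<times> {cs, ca}) (down n p cs ca s)"
proof -
  \<comment> \<open>An odd start fits \<open>down\<close>, which first writes the complement into
    \<open>cs\<close>.\<close>
  have "odd (first_row n p)"
    using n by (cases p) auto
  moreover have "first_row n p + x \<in> part_rows q p" if "0 \<le> x" "x < 2 * half_height n p" for x
    using that n by (cases p) (auto simp: part_rows_def)
  ultimately have "fills (entry q) ({first_row n p..<first_row n p + 2 * half_height n p} \<times> {cs, ca})
      (down n p cs ca s)"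
    using cols start n by (intro fills_down) (auto simp: entry_def)
  then show ?thesis
    by (rule fills_mono) (use n in \<open>cases p; auto simp: part_rows_def\<close>)
qed

lemma fills_entry_ops:
  assumes n: "n = 8*q" and j: "0 \<le> j" "j < q"
  shows "fills (entry q)
     ({1..8*q} \<times> {2*q - 2*j, 2*q + 1 + 2*j, 2*q - 1 - 2*j, 2*q + 2 + 2*j,
                   8*q - 2*j, 4*q + 1 + 2*j, 8*q - 1 - 2*j, 4*q + 2 + 2*j})
     (fold (\<lambda>f B. f B) (left_ops n j @ right_ops n j))" (is "fills _ ?all _")
proof -
  have divs: "n div 2 = 4*q" "n div 4 = 2*q" "3 * n div 4 = 6*q" "3 * n div 2 = 12*q"
    "7 * n div 4 = 14*q" "n\<^sup>2 div 4 = 16*(q*q)"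
    using n by (simp_all add: power2_eq_square)
  \<comment> \<open>The right side repeats the left with ranks raised by \<open>2*q\<close>,
    matching the offset \<open>16*(q*q) = 8*q*(2*q)\<close> of its starting numbers.\<close>
  have cols: "outer_col q (2*q - 2*j)" "\<not> outer_col q (2*q + 1 + 2*j)"
    "outer_col q (2*q - 1 - 2*j)" "\<not> outer_col q (2*q + 2 + 2*j)"
    "outer_col q (8*q - 2*j)" "\<not> outer_col q (4*q + 1 + 2*j)"
    "outer_col q (8*q - 1 - 2*j)" "\<not> outer_col q (4*q + 2 + 2*j)"
    "col_rank q (2*q - 2*j) = 2*j" "col_rank q (2*q + 1 + 2*j) = 2*j"
    "col_rank q (2*q - 1 - 2*j) = 2*j + 1" "col_rank q (2*q + 2 + 2*j) = 2*j + 1"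
    "col_rank q (8*q - 2*j) = 2*(q + j)" "col_rank q (4*q + 1 + 2*j) = 2*(q + j)"
    "col_rank q (8*q - 1 - 2*j) = 2*(q + j) + 1" "col_rank q (4*q + 2 + 2*j) = 2*(q + j) + 1"
    using j by (simp_all add: outer_col_def col_rank_def)
  have rows: "R \<in> part_rows q Top \<Longrightarrow> row_rank q R = 4*q - R"
    "R \<in> part_rows q Middle \<Longrightarrow> row_rank q R = 2*q + R - 1"
    "R \<in> part_rows q Bottom \<Longrightarrow> row_rank q R = 8*q - R" for R
    using j by (simp_all add: part_rows_def row_rank_def)
  let ?C = "\<lambda>a b p. part_rows q p \<times> {a, b}"
  \<comment> \<open>Cells in the order of the operations; \<open>n\<close> stays in the right-hand
    columns so that the list matches \<open>right_ops\<close> syntactically.\<close>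
  let ?Cs = "[?C (2*q - 2*j) (2*q + 1 + 2*j) Bottom, ?C (2*q - 2*j) (2*q + 1 + 2*j) Top,
      ?C (2*q - 2*j) (2*q + 1 + 2*j) Middle,
      ?C (2*q - 1 - 2*j) (2*q + 2 + 2*j) Middle, ?C (2*q - 1 - 2*j) (2*q + 2 + 2*j) Top,
      ?C (2*q - 1 - 2*j) (2*q + 2 + 2*j) Bottom,
      ?C (n - 2*j) (4*q + 1 + 2*j) Bottom, ?C (n - 2*j) (4*q + 1 + 2*j) Top,
      ?C (n - 2*j) (4*q + 1 + 2*j) Middle,
      ?C (n - 1 - 2*j) (4*q + 2 + 2*j) Middle, ?C (n - 1 - 2*j) (4*q + 2 + 2*j) Top,
      ?C (n - 1 - 2*j) (4*q + 2 + 2*j) Bottom]"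
  have "list_all2 (fills (entry q)) ?Cs (left_ops n j @ right_ops n j)"
    unfolding left_ops_def right_ops_def divs append.simps list_all2_Cons
    by (intro conjI fills_entry_up fills_entry_down list_all2_Nil[THEN iffD2] refl n;
      simp add: n cols rows small_value_def) (simp_all add: algebra_simps)
  then have filled: "fills (entry q) (\<Union>(set ?Cs)) (fold (\<lambda>f B. f B) (left_ops n j @ right_ops n j))"
    by (rule fills_fold_ops)
  have "{1..8*q} \<subseteq> part_rows q Top \<union> part_rows q Middle \<union> part_rows q Bottom"
    by (auto simp: part_rows_def)
  then have pair: "{1..8*q} \<times> {a, b} \<subseteq> \<Union>\<C>"
    if "{?C a b Bottom, ?C a b Top, ?C a b Middle} \<subseteq> \<C>" for a b \<C>
    using that by blast
  have "{1..8*q} \<times> {2*q - 2*j, 2*q + 1 + 2*j} \<union> {1..8*q} \<times> {2*q - 1 - 2*j, 2*q + 2 + 2*j} \<union>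
      {1..8*q} \<times> {8*q - 2*j, 4*q + 1 + 2*j} \<union> {1..8*q} \<times> {8*q - 1 - 2*j, 4*q + 2 + 2*j}
      \<subseteq> \<Union>(set ?Cs)"
    by (intro Un_least pair)
      (simp_all only: n list.set insert_subset insert_iff empty_subsetI simp_thms)
  moreover have "?all = {1..8*q} \<times> {2*q - 2*j, 2*q + 1 + 2*j} \<union>
      {1..8*q} \<times> {2*q - 1 - 2*j, 2*q + 2 + 2*j} \<union>
      {1..8*q} \<times> {8*q - 2*j, 4*q + 1 + 2*j} \<union> {1..8*q} \<times> {8*q - 1 - 2*j, 4*q + 2 + 2*j}"
    by blast
  ultimately have "?all \<subseteq> \<Union>(set ?Cs)"
    by (simp only:)
  with filled show ?thesis
    by (rule fills_mono)
qed

lemma procedure_eq_entry: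
  assumes n: "n = 8*q" and i: "i \<in> {1..n}" and c: "c \<in> {1..n}"
  shows "procedure n A i c = entry q i c"
proof -
  let ?C = "\<lambda>j. {1..8*q} \<times> {2*q - 2*j, 2*q + 1 + 2*j, 2*q - 1 - 2*j, 2*q + 2 + 2*j,
                   8*q - 2*j, 4*q + 1 + 2*j, 8*q - 1 - 2*j, 4*q + 2 + 2*j}"
  have "fills (entry q) (\<Union>j\<in>set [0..n div 8 - 1]. ?C j) (procedure n)"
    unfolding procedure_def
    by (rule fills_fold, rule fills_entry_ops) (use n in auto)
  moreover have "\<exists>j\<in>set [0..n div 8 - 1]. (i, c) \<in> ?C j"
  proof -
    \<comment> \<open>In each quarter of the columns \<open>k\<close> is the column rank, reduced by
      \<open>2*q\<close> on the right side, and \<open>j\<close> is \<open>k div 2\<close>.\<close>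
    consider "c \<le> 2*q" | "2*q < c" "c \<le> 4*q" | "4*q < c" "c \<le> 6*q" | "6*q < c"
      by linarith
    then obtain k j where k: "2*j \<le> k" "k \<le> 2*j + 1" "0 \<le> k" "k < 2*q"
      and "c = 2*q - k \<or> c = 2*q + 1 + k \<or> c = 4*q + 1 + k \<or> c = 8*q - k"
    proof cases
      case 1
      show ?thesis by (rule that[of "(2*q - c) div 2" "2*q - c"]) (use 1 c in auto)
    next
      case 2
      show ?thesis by (rule that[of "(c - 2*q - 1) div 2" "c - 2*q - 1"]) (use 2 in auto)
    next
      case 3
      show ?thesis by (rule that[of "(c - 4*q - 1) div 2" "c - 4*q - 1"]) (use 3 in auto)
    next
      case 4
      show ?thesis by (rule that[of "(8*q - c) div 2" "8*q - c"]) (use 4 c n in auto)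
    qed
    moreover have "k = 2*j \<or> k = 2*j + 1"
      using k by linarith
    ultimately have "(i, c) \<in> ?C j" "j \<in> set [0..n div 8 - 1]"
      using i n by auto
    then show ?thesis by blast
  qed
  ultimately show ?thesis
    unfolding fills_def by blast
qed

section \<open>Every number occurs once\<close>

text \<open>An explicit inverse: replace \<open>m\<close> by the smaller of \<open>m\<close> and its
  complement, split that in base \<open>8*q\<close> into column rank and position, undo the reversal
  for odd ranks, and invert both rank functions.\<close>

lemma entry_surj:
  assumes q: "0 < q" and m: "m \<in> {1..(8*q)\<^sup>2}"
  shows "\<exists>R\<in>{1..8*q}. \<exists>c\<in>{1..8*q}. entry q R c = m"
proof -
  define v where "v = (if m \<le> 32*(q*q) then m else NN (8*q) - m)"
  have v: "1 \<le> v" "v \<le> 32*(q*q)"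
    using m by (auto simp: v_def NN_def power2_eq_square)
  define d where "d = (v - 1) div (8*q)"
  define w where "w = (v - 1) mod (8*q)"
  have vdw: "v = 8*q*d + w + 1"
    by (simp add: d_def w_def)
  have w: "0 \<le> w" "w < 8*q"
    using q by (simp_all add: w_def)
  have "8*q*d < 8*q*(4*q)"
    using v w vdw by linarith
  then have "d < 4*q"
    by (rule mult_left_less_imp_less) (use q in simp)
  moreover have "0 \<le> d"
    using q v by (simp add: d_def pos_imp_zdiv_nonneg_iff)
  ultimately have d: "0 \<le> d" "d < 4*q"
    by simp_all
  define u where "u = (if even d then w else 8*q - 1 - w)"
  define R where "R = (if u < 2*q then 8*q - u else if u < 4*q then 4*q - u else u - 2*q + 1)"
  \<comment> \<open>Of the two columns of rank \<open>d\<close>, row parity and the test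
    \<open>v = m\<close>, which says that \<open>m\<close> is small, select the outer or the inner
    one.\<close>
  define c where "c = (if even R \<longleftrightarrow> v = m then if d < 2*q then 2*q - d else 10*q - d
     else d + 2*q + 1)"
  have u: "0 \<le> u" "u < 8*q"
    using w by (auto simp: u_def)
  have R: "R \<in> {1..8*q}" "row_rank q R = u"
    using u by (auto simp: R_def row_rank_def)
  have c: "c \<in> {1..8*q}" "col_rank q c = d" "outer_col q c \<longleftrightarrow> (even R \<longleftrightarrow> v = m)"
    using d by (auto simp: c_def col_rank_def outer_col_def)
  have "small_value q d u = v"
    by (simp add: small_value_def vdw u_def)
  then have "entry q R c = m"
    using R c by (auto simp: entry_def v_def split: if_splits)
  then show ?thesis
    using R c by blast
qed

text \<open>Uniqueness comes from counting: a map from \<open>(8*q)^2\<close> cells that hits as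
  many values is injective.\<close>

lemma entries_once_entry:
  assumes q: "0 < q"
  shows "entries_once (8*q) (entry q)"
proof -
  let ?S = "{1..8*q} \<times> {1..8*q}" and ?f = "\<lambda>p. entry q (fst p) (snd p)"
  have sub: "{1..(8*q)\<^sup>2} \<subseteq> ?f ` ?S"
    using entry_surj[OF q] by force
  have card: "card ?S = card {1..(8*q)\<^sup>2}"
    using q by (simp add: card_cartesian_product power2_eq_square nat_mult_distrib)
  have "card {1..(8*q)\<^sup>2} \<le> card (?f ` ?S)"
    using sub by (intro card_mono) auto
  moreover have "card (?f ` ?S) \<le> card ?S"
    by (intro card_image_le) auto
  ultimately have "card (?f ` ?S) = card ?S"
    using card by linarith
  then have "inj_on ?f ?S"
    by (intro eq_card_imp_inj_on) auto
  then show ?thesis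
    using sub unfolding entries_once_def inj_on_def by blast
qed

section \<open>The sums\<close>

definition alt :: "int \<Rightarrow> int" where
  "alt x = (if even x then 1 else - 1)"

text \<open>The function \<open>a\<close> of the formula. The rank is centred, so two rows of equal
  parity with ranks adding up to \<open>8*q - 1\<close> cancel.\<close>

definition row_coeff :: "int \<Rightarrow> int \<Rightarrow> int" where
  "row_coeff q R = alt R * (2 * row_rank q R + 1 - 8*q)"

text \<open>The function \<open>b\<close> of the formula; \<open>8*q * (2*d + 1) + 1\<close> is
  twice the mean of the run of small numbers of rank \<open>d\<close>.\<close>

definition col_coeff :: "int \<Rightarrow> int \<Rightarrow> int" where
  "col_coeff q c = (if outer_col q c then 1 else - 1) * (8*q * (2 * col_rank q c + 1) + 1 - NN (8*q))"

lemma small_value_alt: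
  "2 * small_value q d u = 8*q * (2*d + 1) + 1 + alt d * (2*u + 1 - 8*q)"
  by (simp add: small_value_def alt_def algebra_simps)

lemma alt_col_rank: "alt (col_rank q c) = (if outer_col q c then alt c else - alt c)"
  by (auto simp: alt_def col_rank_def outer_col_def)

text \<open>\<open>2 * entry - N\<close> is \<open>2 * small_value - N\<close> with sign
  \<open>alt R\<close> times the outer/inner sign. By \<open>alt_col_rank\<close> the latter times
  \<open>alt\<close> of the rank is \<open>alt c\<close>, which separates row from column.\<close>

lemma entry_split:
  "2 * entry q R c = NN (8*q) + alt R * col_coeff q c + alt c * row_coeff q R"
proof (cases "even R \<longleftrightarrow> outer_col q c")
  case True
  then have "2 * entry q R c = 2 * small_value q (col_rank q c) (row_rank q R)"
    by (simp add: entry_def)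
  with True show ?thesis
    by (cases "even R") (simp_all add: small_value_alt alt_col_rank row_coeff_def col_coeff_def
        alt_def[of R] algebra_simps)
next
  case False
  then have "2 * entry q R c = 2 * NN (8*q) - 2 * small_value q (col_rank q c) (row_rank q R)"
    by (simp add: entry_def)
  with False show ?thesis
    by (cases "even R") (simp_all add: small_value_alt alt_col_rank row_coeff_def col_coeff_def
        alt_def[of R] algebra_simps)
qed

section \<open>Pairing summands over integer intervals\<close>

lemma sum_shift_int:
  fixes f :: "int \<Rightarrow> int"
  assumes "0 \<le> m"
  shows "sum f {a..<a + 2*m} = (\<Sum>x\<in>{a..<a + m}. f x + f (x + m))"
proof -
  have "sum f {a..<a + 2*m} = sum f {a..<a + m} + sum f {a + m..<a + m + m}"
    using assms by (subst sum.union_disjoint[symmetric]) (auto intro!: sum.cong)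
  also have "sum f {a + m..<a + m + m} = (\<Sum>x\<in>{a..<a + m}. f (x + m))"
    by (rule sum.reindex_bij_witness[of _ "\<lambda>x. x + m" "\<lambda>x. x - m"]) auto
  finally show ?thesis
    by (simp add: sum.distrib)
qed

lemma sum_shift_const_int:
  fixes f :: "int \<Rightarrow> int"
  assumes "0 \<le> m" and "\<And>x. x \<in> {a..<a + m} \<Longrightarrow> f x + f (x + m) = K"
  shows "sum f {a..<a + 2*m} = m * K"
  using assms by (simp add: sum_shift_int)

text \<open>Adds the sum to its reversal; the factor 2 also covers odd \<open>m\<close>, where the
  midpoint is its own partner.\<close>

lemma sum_reflect_int:
  fixes f :: "int \<Rightarrow> int"
  assumes "0 \<le> m" and "\<And>x. x \<in> {a..<a + m} \<Longrightarrow> f x + f (2*a + m - 1 - x) = K"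
  shows "2 * sum f {a..<a + m} = m * K"
proof -
  have "sum f {a..<a + m} = (\<Sum>x\<in>{a..<a + m}. f (2*a + m - 1 - x))"
    by (rule sum.reindex_bij_witness[of _ "\<lambda>x. 2*a + m - 1 - x" "\<lambda>x. 2*a + m - 1 - x"]) auto
  then have "2 * sum f {a..<a + m} = (\<Sum>x\<in>{a..<a + m}. f x + f (2*a + m - 1 - x))"
    by (simp add: sum.distrib)
  also have "\<dots> = (\<Sum>x\<in>{a..<a + m}. K)"
    using assms(2) by (intro sum.cong) auto
  finally show ?thesis
    using assms(1) by simp
qed

lemma alt_even [simp]: "even y \<Longrightarrow> alt (x + y) = alt x" "even y \<Longrightarrow> alt (y + x) = alt x"
  "even y \<Longrightarrow> alt (y - x) = alt x"
  by (auto simp: alt_def)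

lemma alt_succ: "alt (x + 1) = - alt x" "alt (1 + x) = - alt x"
  by (auto simp: alt_def)

text \<open>Makes the toroidal conditions no harder than the planar ones: wrapped indices enter the
  sums below through their sign only.\<close>

lemma alt_wrap [simp]: "even n \<Longrightarrow> alt (wrap n x) = alt x"
  by (simp add: alt_def wrap_def) (metis dvd_mod_iff even_add even_diff odd_one)

lemma wrap_range: "0 < n \<Longrightarrow> wrap n x \<in> {1..n}"
  by (simp add: wrap_def add1_zle_eq)

section \<open>Half rows and half columns\<close>

lemma sum_half_row:
  assumes q: "0 < q"
  shows "(\<Sum>c=1..4*q. entry q R c) = 2*q * NN (8*q)"
    and "(\<Sum>c=4*q + 1..8*q. entry q R c) = 2*q * NN (8*q)"
proof -
  \<comment> \<open>Reflecting a half row exchanges the outer and inner column of equal rank, whose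
    entries are complements.\<close>
  have "2 * sum (entry q R) {1..<1 + 4*q} = 4*q * NN (8*q)"
    by (rule sum_reflect_int) (use q in \<open>auto simp: entry_def outer_col_def col_rank_def algebra_simps\<close>)
  moreover have "2 * sum (entry q R) {4*q + 1..<4*q + 1 + 4*q} = 4*q * NN (8*q)"
    by (rule sum_reflect_int) (use q in \<open>auto simp: entry_def outer_col_def col_rank_def algebra_simps\<close>)
  moreover have "{1..<1 + 4*q} = {1..4*q}" "{4*q + 1..<4*q + 1 + 4*q} = {4*q + 1..8*q}"
    by auto
  ultimately show "(\<Sum>c=1..4*q. entry q R c) = 2*q * NN (8*q)"
    "(\<Sum>c=4*q + 1..8*q. entry q R c) = 2*q * NN (8*q)"
    by simp_all
qed

lemma sum_alt:
  assumes "0 \<le> q"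
  shows "sum alt {a..<a + 2*q} = 0"
proof -
  have "2 * sum alt {a..<a + 2*q} = 2*q * 0"
    by (rule sum_reflect_int) (use assms in \<open>auto simp: alt_def\<close>)
  then show ?thesis by simp
qed

lemma sum_entry_col:
  assumes q: "0 < q" and a: "a = 1 \<or> a = 4*q + 1"
  shows "(\<Sum>R\<in>{a..<a + 2*(2*q)}. entry q R c) = 2*q * NN (8*q)"
proof -
  have "entry q R c + entry q (R + 2*q) c = NN (8*q) + alt R * col_coeff q c"
    if "R \<in> {a..<a + 2*q}" for R
  proof -
    \<comment> \<open>Rows \<open>2*q\<close> apart within a half have ranks adding up to
      \<open>8*q - 1\<close>.\<close>
    have "row_coeff q R + row_coeff q (R + 2*q) = 0"
      using a that q by (auto simp: row_coeff_def row_rank_def algebra_simps)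
    moreover have "alt (R + 2*q) = alt R"
      by simp
    ultimately have "2 * (entry q R c + entry q (R + 2*q) c)
        = 2 * (NN (8*q) + alt R * col_coeff q c)"
      using entry_split[of q R c] entry_split[of q "R + 2*q" c] by algebra
    then show ?thesis by simp
  qed
  then have "(\<Sum>R\<in>{a..<a + 2*q}. entry q R c + entry q (R + 2*q) c)
      = (\<Sum>R\<in>{a..<a + 2*q}. NN (8*q) + alt R * col_coeff q c)"
    by (rule sum.cong[OF refl])
  then have "(\<Sum>R\<in>{a..<a + 2*(2*q)}. entry q R c)
      = (\<Sum>R\<in>{a..<a + 2*q}. NN (8*q) + alt R * col_coeff q c)"
    using q sum_shift_int[of "2*q" "\<lambda>R. entry q R c" a] by simp
  also have "\<dots> = 2*q * NN (8*q)"
    using q by (simp add: sum.distrib sum_alt flip: sum_distrib_right)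
  finally show ?thesis .
qed

lemma sum_half_col:
  assumes q: "0 < q"
  shows "(\<Sum>R=1..4*q. entry q R c) = 2*q * NN (8*q)"
    and "(\<Sum>R=4*q + 1..8*q. entry q R c) = 2*q * NN (8*q)"
proof -
  have "{1..4*q} = {1..<1 + 2*(2*q)}" "{4*q + 1..8*q} = {4*q + 1..<4*q + 1 + 2*(2*q)}"
    by auto
  then show "(\<Sum>R=1..4*q. entry q R c) = 2*q * NN (8*q)"
    "(\<Sum>R=4*q + 1..8*q. entry q R c) = 2*q * NN (8*q)"
    using sum_entry_col[OF q] by metis+
qed

section \<open>Bend diagonals\<close>

text \<open>Columns \<open>1 + i\<close> and \<open>8*q - i\<close> have opposite signs, so the row
  coefficients cancel and only the parity of \<open>f i\<close> matters.\<close>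

lemma bend_sum_horizontal:
  assumes q: "0 < q" and row: "\<And>i. alt (f i) = alt (k + i)"
  shows "(\<Sum>i=0..4*q - 1. entry q (f i) (1 + i) + entry q (f i) (8*q - i)) = 4*q * NN (8*q)"
proof -
  let ?g = "\<lambda>i. entry q (f i) (1 + i) + entry q (f i) (8*q - i)"
  have g: "2 * ?g i = 2 * NN (8*q) + alt (k + i) * (col_coeff q (1 + i) + col_coeff q (8*q - i))" for i
    by (simp add: distrib_left entry_split row alt_succ)
  have "sum ?g {0..<0 + 2*(2*q)} = 2*q * (2 * NN (8*q))"
  proof (rule sum_shift_const_int)
    fix i assume i: "i \<in> {0..<0 + 2*q}"
    \<comment> \<open>Two of the four columns are outer and two inner; both pairs have ranks adding
      up to \<open>4*q - 1\<close>.\<close>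
    have "col_coeff q (1 + i) + col_coeff q (8*q - i)
        + (col_coeff q (1 + (i + 2*q)) + col_coeff q (8*q - (i + 2*q))) = 0"
      using i by (simp add: col_coeff_def outer_col_def col_rank_def algebra_simps)
    moreover have "alt (k + (i + 2*q)) = alt (k + i)"
      by (simp add: alt_def)
    ultimately have "2 * (?g i + ?g (i + 2*q)) = 2 * (2 * NN (8*q))"
      using g[of i] g[of "i + 2*q"] by algebra
    then show "?g i + ?g (i + 2*q) = 2 * NN (8*q)"
      by simp
  qed (use q in simp)
  moreover have "{0..<0 + 2*(2*q)} = {0..4*q - 1}" by auto
  ultimately show ?thesis by simp
qed

lemma bend_sum_vertical:
  assumes q: "0 < q" and col: "\<And>i. alt (f i) = alt (k + i)"
  shows "(\<Sum>i=0..4*q - 1. entry q (1 + i) (f i) + entry q (8*q - i) (f i)) = 4*q * NN (8*q)"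
proof -
  let ?g = "\<lambda>i. entry q (1 + i) (f i) + entry q (8*q - i) (f i)"
  have g: "2 * ?g i = 2 * NN (8*q) + alt (k + i) * (row_coeff q (1 + i) + row_coeff q (8*q - i))" for i
    by (simp add: distrib_left entry_split col alt_succ)
  have "sum ?g {0..<0 + 2*(2*q)} = 2*q * (2 * NN (8*q))"
  proof (rule sum_shift_const_int)
    fix i assume i: "i \<in> {0..<0 + 2*q}"
    \<comment> \<open>The rows pair off at distance \<open>2*q\<close>, again with ranks adding up
      to \<open>8*q - 1\<close>.\<close>
    have "row_coeff q (1 + i) + row_coeff q (8*q - i)
        + (row_coeff q (1 + (i + 2*q)) + row_coeff q (8*q - (i + 2*q))) = 0"
      using i by (simp add: row_coeff_def row_rank_def alt_def algebra_simps)
    moreover have "alt (k + (i + 2*q)) = alt (k + i)"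
      by (simp add: alt_def)
    ultimately have "2 * (?g i + ?g (i + 2*q)) = 2 * (2 * NN (8*q))"
      using g[of i] g[of "i + 2*q"] by algebra
    then show "?g i + ?g (i + 2*q) = 2 * NN (8*q)"
      by simp
  qed (use q in simp)
  moreover have "{0..<0 + 2*(2*q)} = {0..4*q - 1}" by auto
  ultimately show ?thesis by simp
qed

lemma franklin_square_entry:
  assumes q: "0 < q"
  shows "franklin_square (8*q) (entry q)"
proof -
  have magic: "magic_sum (8*q) = 4*q * NN (8*q)" "magic_sum (8*q) div 2 = 2*q * NN (8*q)"
    by (simp_all add: magic_sum_def)
  have "half_sums (8*q) (entry q)"
    unfolding half_sums_def magic using sum_half_row[OF q] sum_half_col[OF q] by simp
  \<comment> \<open>Equal parity lets one lemma serve both directions of a bend.\<close>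
  moreover have "alt (k - i) = alt (k + i)" for k i
    by (simp add: alt_def)
  then have "bend_diagonals (8*q) (entry q)"
    unfolding bend_diagonals_def magic
    using bend_sum_horizontal[OF q] bend_sum_vertical[OF q] by simp
  moreover have "two_by_two_sums (8*q) (entry q)"
  proof -
    \<comment> \<open>Adjacent indices have opposite signs, also across the border, so both
      coefficient terms cancel in pairs.\<close>
    have "2 * (entry q i j + entry q i (wrap (8*q) (j + 1)) + entry q (wrap (8*q) (i + 1)) j
        + entry q (wrap (8*q) (i + 1)) (wrap (8*q) (j + 1))) = 2 * (2 * NN (8*q))" for i j
      by (simp add: distrib_left entry_split alt_succ)
    then have "entry q i j + entry q i (wrap (8*q) (j + 1)) + entry q (wrap (8*q) (i + 1)) j
        + entry q (wrap (8*q) (i + 1)) (wrap (8*q) (j + 1)) = 2 * NN (8*q)" for i j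
      by (metis mult_left_cancel zero_neq_numeral)
    then show ?thesis
      unfolding two_by_two_sums_def by blast
  qed
  ultimately show ?thesis
    using entries_once_entry[OF q] unfolding franklin_square_def by blast
qed

text \<open>Needed because \<open>procedure\<close> is known to agree with \<open>entry\<close> only
  inside the square; every index in the four conditions, wrapped or not, lies there.\<close>

lemma franklin_square_cong:
  assumes n: "0 < n" and eq: "\<And>i j. i \<in> {1..n} \<Longrightarrow> j \<in> {1..n} \<Longrightarrow> A i j = B i j"
    and "franklin_square n B"
  shows "franklin_square n A"
proof -
  note w = wrap_range[OF n]
  have "entries_once n A = entries_once n B"
    unfolding entries_once_def using eq by (intro ball_cong refl ex_cong1 arg_cong[where f = Ex1]) auto
  moreover have "half_sums n A = half_sums n B"
    unfolding half_sums_def using eq n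
    by (intro ball_cong refl arg_cong2[where f = "(\<and>)"] arg_cong2[where f = "(=)"] sum.cong) auto
  moreover have "bend_diagonals n A = bend_diagonals n B"
    unfolding bend_diagonals_def using eq w n
    by (intro ball_cong refl arg_cong2[where f = "(\<and>)"] arg_cong2[where f = "(=)"] sum.cong
        arg_cong2[where f = "(+)"]) auto
  moreover have "two_by_two_sums n A = two_by_two_sums n B"
    unfolding two_by_two_sums_def using eq w by (intro ball_cong refl) simp
  ultimately show ?thesis
    using assms(3) unfolding franklin_square_def by simp
qed

theorem proposition2p1:
  fixes r :: nat and n :: int and A\<^sub>0 A :: square
  assumes "r \<ge> 3" and "n = 2 ^ r"
    and "A = procedure n A\<^sub>0"
  shows "franklin_square n A"
proof -
  define q :: int where "q = 2 ^ (r - 3)"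
  have q: "0 < q"
    by (simp add: q_def)
  have n: "n = 8*q"
    using assms(1,2) power_add[of "2::int" 3 "r - 3"] by (simp add: q_def)
  show ?thesis
    unfolding assms(3)
  proof (rule franklin_square_cong[where B = "entry q"])
    show "0 < n" "franklin_square n (entry q)"
      using q n franklin_square_entry[OF q] by simp_all
  qed (rule procedure_eq_entry[OF n])
qed

end
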